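(* For every integer $\ell\geq 0$ and every integer $n\geq 1$, one has the identity of polynomials $$q_{\ell,n}(z) = \prod_{k\mid n} \left( h_k(z)^{\eta_\ell(k)} \prod_{j=2}^{\ell} m_{j,k}(z) \right)$$ where the product runs over all positive divisors $k$ of $n$ and the multiplicity $\eta_\ell(k)$ is given by $$\eta_\ell(k) = \left\lfloor \frac{\ell-1}{k}\right\rfloor + 2 .$$ In other words, the roots of $q_{\ell,n}$ are composed of the points of $\mathrm{Hyp}(k)$ for each divisor $k$ of $n$, which are roots with multiplicity $\eta_\ell(k)$, and of the points of $\mathrm{Mis}(j,k)$ for $2\leq j\leq \ell$ and $k\mid n$, which are simple roots.
   Context: Define polynomials recursively by $p_0(z)=0$ and $p_{n+1}(z)=p_n(z)^2+z$ for $n\ge 0$, and for integers $\ell\geq 0$, $n\geq 1$ put $q_{\ell,n}(z)=p_{\ell+n}(z)-p_\ell(z)$. For $n\ge1$, $\mathrm{Hyp}(n)=\{z\in\mathbb{C} : p_n(z)=0 \text{ and } p_k(z)\neq 0 \text{ for every positive divisor } k\neq n \text{ of } n\}$. For $\ell\ge 2$, $n\geq 1$, $\mathrm{Mis}(\ell,n)=\{z\in\mathbb{C} : q_{\ell,n}(z)=0,\ q_{\ell-1,n}(z)\neq 0,\ \text{and } q_{\ell,k}(z)\neq 0 \text{ for every positive divisor } k\neq n \text{ of } n\}$. The reduced polynomials are $h_n(z)=\prod_{r\in \mathrm{Hyp}(n)}(z-r)$ and $m_{\ell,n}(z)=\prod_{r\in\mathrm{Mis}(\ell,n)}(z-r)$.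 Here $\lfloor\cdot\rfloor$ is the floor function (so $\lfloor -1/k\rfloor=-1$ for $k\geq 1$), and empty products equal $1$. *)

theory Defs
  imports Complex_Main "HOL-Computational_Algebra.Polynomial"
begin

fun p :: "nat \<Rightarrow> complex poly" where
  "p 0 = 0"
| "p (Suc n) = (p n)\<^sup>2 + [:0, 1:]"

definition q :: "nat \<Rightarrow> nat \<Rightarrow> complex poly" where
  "q l n = p (l + n) - p l"

definition Hyp :: "nat \<Rightarrow> complex set" where
  "Hyp n = {z. poly (p n) z = 0 \<and>
     (\<forall>k. 0 < k \<and> k dvd n \<and> k \<noteq> n \<longrightarrow> poly (p k) z \<noteq> 0)}"

text \<open>\<open>Mis l n\<close> is only meaningful (and only used) for \<open>l \<ge> 2\<close> and \<open>n \<ge> 1\<close>,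
  where the subtraction \<open>l - 1\<close> is not truncated.\<close>

definition Mis :: "nat \<Rightarrow> nat \<Rightarrow> complex set" where
  "Mis l n = {z. poly (q l n) z = 0 \<and> poly (q (l - 1) n) z \<noteq> 0 \<and>
     (\<forall>k. 0 < k \<and> k dvd n \<and> k \<noteq> n \<longrightarrow> poly (q l k) z \<noteq> 0)}"

text \<open>A product over an infinite set would be \<open>1\<close> by convention. The lemmas
  \<open>finite_Hyp\<close> and \<open>finite_Mis\<close> below show that this never happens for \<open>n \<ge> 1\<close>.\<close>

definition h :: "nat \<Rightarrow> complex poly" where
  "h n = (\<Prod>r\<in>Hyp n. [:- r, 1:])"

definition m :: "nat \<Rightarrow> nat \<Rightarrow> complex poly" where
  "m l n = (\<Prod>r\<in>Mis l n. [:- r, 1:])"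

text \<open>For \<open>k \<ge> 1\<close> the integer inside \<open>nat\<close> is at least \<open>1\<close>; the subtraction \<open>l - 1\<close>
  is taken in the reals, so that \<open>\<eta> 0 k = 1\<close>.\<close>

definition \<eta> :: "nat \<Rightarrow> nat \<Rightarrow> nat" where
  "\<eta> l k = nat (\<lfloor>(real l - 1) / real k\<rfloor> + 2)"

lemma degree_p: "degree (p (Suc n)) = 2 ^ n"
proof (induction n)
  case (Suc n)
  have "p (Suc n) \<noteq> 0"
    using Suc.IH by (metis degree_0 power_not_zero zero_neq_numeral)
  then have d: "degree ((p (Suc n))\<^sup>2) = 2 ^ Suc n"
    using Suc.IH by (simp add: degree_power_eq del: p.simps)
  have "degree [:0, 1 :: complex:] < degree ((p (Suc n))\<^sup>2)"
    unfolding d using one_less_power[of "2::nat" "Suc n"] by simp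
  then show ?case
    by (subst p.simps(2)) (simp only: degree_add_eq_left d)
qed simp

lemma p_nonzero: "n \<ge> 1 \<Longrightarrow> p n \<noteq> 0"
  by (metis degree_0 degree_p not_one_le_zero old.nat.exhaust power_not_zero zero_neq_numeral)

lemma q_nonzero:
  assumes "n \<ge> 1"
  shows "q l n \<noteq> 0"
proof (cases l)
  case 0
  with assms p_nonzero show ?thesis by (simp add: q_def)
next
  case (Suc l')
  have "degree (p (Suc (l' + n))) \<noteq> degree (p (Suc l'))"
    using assms by (simp add: degree_p del: p.simps)
  then have "p (Suc (l' + n)) \<noteq> p (Suc l')" by metis
  with Suc show ?thesis by (simp add: q_def del: p.simps)
qed

lemma finite_Hyp: "n \<ge> 1 \<Longrightarrow> finite (Hyp n)"
  by (rule finite_subset[OF _ poly_roots_finite[OF p_nonzero]]) (auto simp: Hyp_def)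

lemma finite_Mis: "n \<ge> 1 \<Longrightarrow> finite (Mis l n)"
  by (rule finite_subset[OF _ poly_roots_finite[OF q_nonzero]]) (auto simp: Mis_def)

end

theory Submission
  imports Defs "HOL-Computational_Algebra.Fundamental_Theorem_Algebra"
begin

text \<open>
  Write \<open>x i = p i z\<close> for the critical orbit. Since
  \<open>q (a + 1) n = q a n * (p (a + n) + p a)\<close> and \<open>q 0 n = p n\<close>, the multiplicity of \<open>z\<close> as a
  root of \<open>q l n\<close> is obtained by counting the \<open>a < l\<close> with \<open>x (a + n) = - x a\<close>, once it is known
  that \<open>p n\<close> and \<open>p (a + n) + p a\<close> (\<open>a \<ge> 1\<close>) have only simple roots. For this, let \<open>I\<close> be
  the ideal of integer polynomials vanishing at a root of a monic integer polynomial; by Gauss' lemma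
  \<open>I\<close> contains no polynomial of the form \<open>1 + 2 f\<close>. The derivative of \<open>p n\<close> is of this form.
  For \<open>p (a + n) + p a\<close>, half of the derivative is congruent modulo 2 to
  \<open>1 + p (a + n - 1) + p (a - 1)\<close>, and \<open>(p (a + n - 1) + p (a - 1))\<^sup>2\<close> is congruent modulo 2 to
  \<open>p (a + n) + p a\<close>, which again yields an element \<open>1 + 2 f\<close> of \<open>I\<close> at a double root.
\<close>

section \<open>Integer polynomials at an algebraic integer\<close>

abbreviation ipoly :: "int poly \<Rightarrow> complex poly" where
  "ipoly \<equiv> map_poly of_int"

lemma ipoly_add: "ipoly (f + g) = ipoly f + ipoly g"
  by (rule poly_eqI) (simp add: coeff_map_poly)

lemma ipoly_mult: "ipoly (f * g) = ipoly f * ipoly g"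
  by (rule poly_eqI) (simp add: coeff_map_poly coeff_mult)

lemma ipoly_smult: "ipoly (smult c f) = smult (of_int c) (ipoly f)"
  by (rule poly_eqI) (simp add: coeff_map_poly)

lemma ipoly_pderiv: "ipoly (pderiv f) = pderiv (ipoly f)"
  by (rule poly_eqI) (simp add: coeff_map_poly coeff_pderiv)

lemma degree_ipoly: "degree (ipoly f) = degree f"
  by (rule degree_map_poly) simp

text \<open>Modulo 2, \<open>g\<close> keeps its positive degree, so it is not a unit. The induction
  carries this out over the integers by stripping even leading terms from \<open>t\<close>.\<close>

lemma odd_lead_coeff_mult_ne:
  fixes g t f :: "int poly"
  assumes "odd (lead_coeff g)" "degree g > 0"
  shows "g * t \<noteq> 1 + smult 2 f"
proof (induction "degree t" arbitrary: t f rule: less_induct)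
  case less
  show ?case
  proof
    assume eq: "g * t = 1 + smult 2 f"
    have t0: "t \<noteq> 0"
    proof
      assume "t = 0"
      with eq have "coeff (1 + smult 2 f) 0 = 0" by simp
      then have "1 + 2 * coeff f 0 = 0" by simp
      then show False by presburger
    qed
    have "coeff (1 + smult 2 f) (degree g + degree t) = lead_coeff g * lead_coeff t"
      unfolding eq[symmetric] by (rule coeff_mult_degree_sum)
    \<comment> \<open>As \<open>degree g > 0\<close>, the constant 1 does not reach this
      coefficient.\<close>
    moreover have "coeff (1 + smult 2 f) (degree g + degree t) = 2 * coeff f (degree g + degree t)"
      using assms by (simp add: coeff_1)
    ultimately have "even (lead_coeff g * lead_coeff t)" by (metis dvd_triv_left)
    with assms have "even (lead_coeff t)" by simp
    then obtain c where c: "lead_coeff t = 2 * c" by blast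
    define u where "u = monom c (degree t)"
    define t' where "t' = t - smult 2 u"
    have eq': "g * t' = 1 + smult 2 (f - g * u)"
      by (simp add: t'_def right_diff_distrib eq smult_diff_right)
    have top: "coeff t' (degree t) = 0"
      by (simp add: t'_def u_def c)
    have le: "degree t' \<le> degree t"
      unfolding t'_def u_def
      by (intro degree_diff_le) (auto intro: order.trans[OF degree_smult_le] degree_monom_le)
    show False
    proof (cases "degree t' < degree t")
      case True
      with less eq' show False by blast
    \<comment> \<open>The degree can fail to drop only if \<open>t'\<close> vanishes; the odd
      constant coefficient then rules this out.\<close>
    next
      case False
      with le top have "t' = 0" by (metis leading_coeff_0_iff nat_less_le)
      with eq' have "coeff (1 + smult 2 (f - g * u)) 0 = 0" by simp
      then have "1 + 2 * coeff (f - g * u) 0 = 0" by simp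
      then show False by presburger
    qed
  qed
qed

text \<open>That the minimal polynomial \<open>g\<close> divides in \<open>\<int>[X]\<close>
  every integer polynomial vanishing at \<open>r\<close> is Gauss' lemma.\<close>

lemma exists_int_minimal_poly:
  assumes "P \<noteq> 0" "poly (ipoly P) r = 0"
  obtains g where "g \<noteq> 0" "poly (ipoly g) r = 0" "\<And>f. poly (ipoly f) r = 0 \<Longrightarrow> g dvd f"
proof -
  define V where "V f \<longleftrightarrow> f \<noteq> 0 \<and> poly (ipoly f) r = 0" for f
  define g0 where "g0 = arg_min degree V"
  have "V P" using assms by (simp add: V_def)
  then have V0: "V g0" and min0: "\<And>f. V f \<Longrightarrow> degree g0 \<le> degree f"
    unfolding g0_def by (auto intro: arg_min_natI arg_min_nat_le)
  \<comment> \<open>Least degree makes pseudo-remainders vanish; primitivity lets integer factors be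
    cancelled.\<close>
  define g where "g = primitive_part g0"
  have g: "g \<noteq> 0" using V0 by (simp add: g_def V_def)
  have cont: "content g = 1" using V0 by (simp add: g_def V_def)
  have "poly (ipoly g0) r = of_int (content g0) * poly (ipoly g) r"
    unfolding g_def by (metis content_times_primitive_part ipoly_smult poly_smult)
  moreover have "poly (ipoly g0) r = 0" "content g0 \<noteq> 0" using V0 by (simp_all add: V_def)
  ultimately have gr: "poly (ipoly g) r = 0" by simp
  have "g dvd f" if f: "poly (ipoly f) r = 0" for f
  proof -
    obtain a s where a: "a \<noteq> 0" and s: "smult a f = g * s + pseudo_mod f g"
      using pseudo_mod(1)[OF g] by blast
    have "ipoly (smult a f) = ipoly g * ipoly s + ipoly (pseudo_mod f g)"
      by (simp add: s ipoly_add ipoly_mult)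
    then have "poly (ipoly (smult a f)) r = poly (ipoly g * ipoly s + ipoly (pseudo_mod f g)) r"
      by (rule arg_cong)
    then have "poly (ipoly (pseudo_mod f g)) r = 0"
      using f gr by (simp add: ipoly_smult)
    then have "pseudo_mod f g = 0"
      using pseudo_mod(2)[OF g, of f] min0[of "pseudo_mod f g"]
      by (metis V_def degree_primitive_part g_def leD)
    then have "g dvd smult a f" using s by simp
    \<comment> \<open>Passing to primitive parts removes the factor \<open>a\<close> of the
      pseudo-division up to its sign.\<close>
    then have "primitive_part g dvd primitive_part (smult a f)"
      by (rule primitive_part_dvd_primitive_partI)
    then have "g dvd smult (unit_factor a) (primitive_part f)"
      by (simp add: primitive_part_prim[OF cont] primitive_part_smult)
    \<comment> \<open>\<open>content f\<close> restores \<open>f\<close>, and the second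
      \<open>unit_factor a\<close> cancels the sign.\<close>
    then have "g dvd smult (content f * unit_factor a) (smult (unit_factor a) (primitive_part f))"
      by (rule dvd_smult)
    also have "smult (content f * unit_factor a) (smult (unit_factor a) (primitive_part f))
        = smult (unit_factor a * unit_factor a) (smult (content f) (primitive_part f))"
      by (simp only: smult_smult mult_ac)
    also have "\<dots> = f"
      using a by (simp add: sgn_if)
    finally show ?thesis .
  qed
  with g gr show ?thesis by (rule that)
qed

text \<open>The minimal polynomial of \<open>r\<close> divides the monic \<open>P\<close>, so its
  leading coefficient is odd; having a root, it is not constant. It cannot then divide
  \<open>1 + smult 2 f\<close>.\<close>

lemma monic_root_not_root_one_plus_twice:
  assumes "lead_coeff P = 1" "poly (ipoly P) r = 0"
  shows "poly (ipoly (1 + smult 2 f)) r \<noteq> 0"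
proof
  assume Q: "poly (ipoly (1 + smult 2 f)) r = 0"
  have "P \<noteq> 0" using assms by auto
  then obtain g where g: "g \<noteq> 0" "poly (ipoly g) r = 0"
    and dvd: "\<And>f. poly (ipoly f) r = 0 \<Longrightarrow> g dvd f"
    using assms(2) by (rule exists_int_minimal_poly) blast
  obtain u where "P = g * u" using dvd[OF assms(2)] by blast
  with assms(1) have "lead_coeff g * lead_coeff u = 1" by (simp add: lead_coeff_mult)
  then have "odd (lead_coeff g)" by (metis dvd_mult2 odd_one)
  moreover have "degree g > 0"
  proof (rule ccontr)
    assume "\<not> degree g > 0"
    then obtain c where "g = [:c:]" using degree_eq_zeroE by blast
    with g show False by (simp add: map_poly_pCons)
  qed
  moreover obtain t where "1 + smult 2 f = g * t" using dvd[OF Q] by blast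
  ultimately show False using odd_lead_coeff_mult_ne by metis
qed

section \<open>Simple roots\<close>

fun pI :: "nat \<Rightarrow> int poly" where
  "pI 0 = 0"
| "pI (Suc n) = (pI n)\<^sup>2 + [:0, 1:]"

lemma ipoly_pI: "ipoly (pI n) = p n"
  by (induction n) (simp_all add: ipoly_add ipoly_mult power2_eq_square map_poly_pCons)

lemma lead_coeff_p: "lead_coeff (p (Suc n)) = 1"
proof (induction n)
  case (Suc n)
  have d: "degree ((p (Suc n))\<^sup>2) = 2 ^ Suc n"
    using p_nonzero[of "Suc n"] by (simp add: degree_power_eq degree_p del: p.simps)
  have "degree [:0, 1 :: complex:] < degree ((p (Suc n))\<^sup>2)"
    unfolding d using one_less_power[of "2::nat" "Suc n"] by simp
  then have "lead_coeff ([:0, 1:] + (p (Suc n))\<^sup>2) = lead_coeff ((p (Suc n))\<^sup>2)"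
    by (rule lead_coeff_add_le)
  then have "lead_coeff (p (Suc (Suc n))) = (lead_coeff (p (Suc n)))\<^sup>2"
    by (simp only: p.simps(2)[of "Suc n"] add.commute[of _ "[:0, 1:]"] lead_coeff_power)
  with Suc show ?case by simp
qed simp

lemma lead_coeff_p_add:
  assumes "n \<ge> 1"
  shows "lead_coeff (p (a + n) + p a) = 1"
proof -
  obtain k where k: "a + n = Suc k" using assms by (cases "a + n") auto
  have "degree (p a) < degree (p (a + n))"
    using assms k by (cases a) (auto simp: degree_p simp del: p.simps(2))
  then have "lead_coeff (p a + p (a + n)) = lead_coeff (p (a + n))"
    by (rule lead_coeff_add_le)
  with lead_coeff_p[of k] k show ?thesis by (simp only: add.commute[of "p a"])
qed

lemma lead_coeff_q:
  assumes "n \<ge> 1"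
  shows "lead_coeff (q l n) = 1"
proof -
  obtain k where k: "l + n = Suc k" using assms by (cases "l + n") auto
  have "degree (- p l) < degree (p (l + n))"
    using assms k by (cases l) (auto simp: degree_p simp del: p.simps(2))
  then have "lead_coeff (- p l + p (l + n)) = lead_coeff (p (l + n))"
    by (rule lead_coeff_add_le)
  then show ?thesis
    using lead_coeff_p[of k] k by (simp add: q_def del: p.simps)
qed

lemma lead_coeff_ipoly_eq_1:
  assumes "ipoly P = f" "lead_coeff f = 1"
  shows "lead_coeff P = 1"
proof -
  have "of_int (lead_coeff P) = (1 :: complex)"
    using assms by (metis coeff_map_poly degree_ipoly of_int_0)
  then show ?thesis by simp
qed

lemma pderiv_pI_Suc: "pderiv (pI (Suc n)) = 1 + smult 2 (pI n * pderiv (pI n))"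
  by (simp add: power2_eq_square pderiv_add pderiv_mult pderiv_pCons
      flip: numeral_mult_conv_smult)

lemma p_simple_root:
  assumes "n \<ge> 1" "poly (p n) z = 0"
  shows "poly (pderiv (p n)) z \<noteq> 0"
proof -
  obtain k where k: "n = Suc k" using assms(1) by (cases n) auto
  have "lead_coeff (pI n) = 1"
    using lead_coeff_ipoly_eq_1[OF ipoly_pI] lead_coeff_p k by blast
  moreover have "poly (ipoly (pI n)) z = 0" using assms by (simp add: ipoly_pI)
  ultimately have "poly (ipoly (pderiv (pI n))) z \<noteq> 0"
    unfolding k pderiv_pI_Suc by (rule monic_root_not_root_one_plus_twice)
  then show ?thesis by (simp add: ipoly_pderiv ipoly_pI)
qed

text \<open>For \<open>k > 0\<close> the derivative is 1 modulo 2; for \<open>k = 0\<close> both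
  sides vanish with \<open>w = 0\<close>.\<close>

lemma pI_mult_pderiv_mod_2: "\<exists>w. pI k * pderiv (pI k) = pI k + smult 2 w"
proof (cases k)
  case (Suc j)
  have "pI k * pderiv (pI k) = pI k + smult 2 (pI k * (pI j * pderiv (pI j)))"
    unfolding Suc pderiv_pI_Suc by (simp add: algebra_simps del: pI.simps)
  then show ?thesis ..
qed (auto intro: exI[of _ 0])

lemma p_add_simple_root:
  assumes "n \<ge> 1" "a \<ge> 1" and root: "poly (p (a + n) + p a) z = 0"
  shows "poly (pderiv (p (a + n) + p a)) z \<noteq> 0"
proof
  assume "poly (pderiv (p (a + n) + p a)) z = 0"
  then have dS: "poly (ipoly (pderiv (pI (a + n) + pI a))) z = 0"
    by (simp add: ipoly_pderiv ipoly_pI ipoly_add)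
  obtain b where b: "a = Suc b" using assms by (cases a) auto
  define A B where "A = pI (b + n)" and "B = pI b"
  define S where "S = pI (a + n) + pI a"
  have S: "S = A\<^sup>2 + B\<^sup>2 + smult 2 [:0, 1:]"
    by (simp add: S_def b A_def B_def numeral_poly flip: smult_one)
  have Sz: "poly (ipoly S) z = 0"
    using root by (simp add: S_def ipoly_add ipoly_pI)
  have lc: "lead_coeff S = 1"
    by (rule lead_coeff_ipoly_eq_1[OF _ lead_coeff_p_add[OF assms(1)]])
      (simp add: S_def ipoly_add ipoly_pI)
  obtain v w where v: "A * pderiv A = A + smult 2 v" and w: "B * pderiv B = B + smult 2 w"
    using pI_mult_pderiv_mod_2 unfolding A_def B_def by metis
  define c where "c = 1 + smult 2 (v + w)"
  have "pderiv S = smult 2 (1 + A * pderiv A + B * pderiv B)"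
    by (simp add: S_def b pderiv_add pderiv_pI_Suc A_def B_def distrib_left
        del: pI.simps flip: numeral_mult_conv_smult)
  also have "\<dots> = smult 2 (c + (A + B))"
    unfolding v w c_def by (simp add: smult_add_right)
  finally have "poly (ipoly (smult 2 (c + (A + B)))) z = 0"
    using dS by (simp add: S_def)
  \<comment> \<open>The factor 2 is cancelled in the complex value, not modulo 2.\<close>
  then have half: "poly (ipoly (c + (A + B))) z = 0"
    by (simp add: ipoly_smult)
  \<comment> \<open>Solved from \<open>c\<^sup>2 - (A + B)\<^sup>2 + S = 1 + 2 f\<close>: the
    squares of \<open>A\<close> and \<open>B\<close> cancel against those in \<open>S\<close>, and
    \<open>c\<close> is 1 modulo 2.\<close>
  define f where "f = smult 2 (v + w) + smult 2 ((v + w)\<^sup>2) - A * B + [:0, 1:]"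
  have "1 + smult 2 f = (c + (A + B)) * (c - (A + B)) + S"
    unfolding f_def c_def S numeral_mult_conv_smult[symmetric] by algebra
  then have "poly (ipoly (1 + smult 2 f)) z = 0"
    using half Sz by (simp add: ipoly_add ipoly_mult)
  with monic_root_not_root_one_plus_twice[OF lc Sz] show False by blast
qed

lemma order_eq_of_bool_of_simple_roots:
  fixes f :: "'a :: field_char_0 poly"
  assumes "f \<noteq> 0" "poly f z = 0 \<Longrightarrow> poly (pderiv f) z \<noteq> 0"
  shows "order z f = of_bool (poly f z = 0)"
proof (cases "poly f z = 0")
  case True
  then have "order z f \<noteq> 0" using assms(1) by (simp add: order_root)
  moreover have "order z (pderiv f) = 0" using assms(2) True by (simp add: order_0I)
  moreover have "pderiv f \<noteq> 0" using assms(2) True by auto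
  ultimately show ?thesis using order_pderiv[of f z] True assms by simp
qed (simp add: order_0I)

lemma q_Suc: "q (Suc a) n = q a n * (p (a + n) + p a)"
  by (simp add: q_def power2_eq_square algebra_simps)

lemma order_q:
  assumes "n \<ge> 1"
  shows "order z (q l n) = of_bool (poly (p n) z = 0)
    + card {a. a < l \<and> poly (p (a + n) + p a) z = 0}"
proof (induction l)
  case 0
  show ?case
    using order_eq_of_bool_of_simple_roots[OF p_nonzero p_simple_root] assms by (simp add: q_def)
next
  case (Suc l)
  have nz: "p (l + n) + p l \<noteq> 0" using lead_coeff_p_add[OF assms, of l]
    by (metis leading_coeff_0_iff zero_neq_one)
  \<comment> \<open>For \<open>l = 0\<close> the new factor is \<open>p n\<close> itself, which
    needs the separate simplicity result.\<close>
  have "poly (pderiv (p (l + n) + p l)) z \<noteq> 0" if "poly (p (l + n) + p l) z = 0"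
    using that p_simple_root[OF assms] p_add_simple_root[OF assms _ that]
    by (cases "l = 0") auto
  then have "order z (p (l + n) + p l) = of_bool (poly (p (l + n) + p l) z = 0)"
    using nz by (rule order_eq_of_bool_of_simple_roots[rotated])
  moreover have "order z (q (Suc l) n) = order z (q l n) + order z (p (l + n) + p l)"
    using q_nonzero[OF assms, of "Suc l"] unfolding q_Suc by (rule order_mult)
  moreover have "{a. a < Suc l \<and> poly (p (a + n) + p a) z = 0}
      = {a. a < l \<and> poly (p (a + n) + p a) z = 0}
        \<union> (if poly (p (l + n) + p l) z = 0 then {l} else {})"
    by (auto simp: less_Suc_eq)
  moreover have "card \<dots> = card {a. a < l \<and> poly (p (a + n) + p a) z = 0}
      + of_bool (poly (p (l + n) + p l) z = 0)"
    by (subst card_Un_disjoint) auto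
  ultimately show ?case using Suc by simp
qed

section \<open>The critical orbit\<close>

lemma p_orbit_shift:
  assumes "poly (p i) z = poly (p j) z"
  shows "poly (p (i + k)) z = poly (p (j + k)) z"
  using assms by (induction k) simp_all

lemma p_orbit_mult:
  assumes "poly (p (l + k)) z = poly (p l) z"
  shows "poly (p (l + k * u)) z = poly (p l) z"
proof (induction u)
  case (Suc u)
  then show ?case using p_orbit_shift[OF Suc, of k] assms by (simp add: algebra_simps)
qed simp

lemma p_orbit_dvd:
  assumes "poly (p (l + k)) z = poly (p l) z" "k dvd n"
  shows "poly (p (l + n)) z = poly (p l) z"
  using assms p_orbit_mult by (elim dvdE) blast

lemma p_orbit_ge:
  assumes "poly (p (l + k)) z = poly (p l) z" "l \<le> i"
  shows "poly (p (i + k)) z = poly (p i) z"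
  using p_orbit_shift[OF assms(1), of "i - l"] assms(2) by (simp add: algebra_simps)

lemma p_orbit_gcd:
  assumes "k > 0" "poly (p (l + k)) z = poly (p l) z" "poly (p (l + k')) z = poly (p l) z"
  shows "poly (p (l + gcd k k')) z = poly (p l) z"
proof -
  \<comment> \<open>Bezout without subtraction: walking \<open>k * u\<close> steps equals walking
    \<open>k' * v\<close> steps and then \<open>gcd k k'\<close> more.\<close>
  obtain u v where uv: "k * u = k' * v + gcd k k'" using bezout_nat[of k k'] assms(1) by auto
  have "poly (p (l + k' * v + gcd k k')) z = poly (p (l + gcd k k')) z"
    by (rule p_orbit_shift[OF p_orbit_mult[OF assms(3)]])
  then show ?thesis using p_orbit_mult[OF assms(2), of u] by (simp add: uv add.assoc)
qed

text \<open>Common form of the conditions in \<open>Hyp\<close> (start index 0) and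
  \<open>Mis\<close>. For \<open>k > 0\<close>, testing proper divisors alone already makes
  \<open>k\<close> the least period, by \<open>exact_period_dvd\<close>.\<close>

definition exact_period :: "nat \<Rightarrow> nat \<Rightarrow> complex \<Rightarrow> bool" where
  "exact_period l k z \<longleftrightarrow> poly (p (l + k)) z = poly (p l) z \<and>
    (\<forall>d. 0 < d \<and> d dvd k \<and> d \<noteq> k \<longrightarrow> poly (p (l + d)) z \<noteq> poly (p l) z)"

lemma Hyp_iff: "z \<in> Hyp k \<longleftrightarrow> exact_period 0 k z"
  by (auto simp: Hyp_def exact_period_def)

lemma Mis_iff: "z \<in> Mis l k \<longleftrightarrow>
    exact_period l k z \<and> poly (p (l - 1 + k)) z \<noteq> poly (p (l - 1)) z"
  by (auto simp: Mis_def exact_period_def q_def)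

text \<open>The gcd of two periods is a period; as a divisor of \<open>k\<close> it must be
  \<open>k\<close>.\<close>

lemma exact_period_dvd:
  assumes "exact_period l k z" "k > 0" "poly (p (l + k')) z = poly (p l) z"
  shows "k dvd k'"
proof -
  have "poly (p (l + gcd k k')) z = poly (p l) z"
    using assms by (intro p_orbit_gcd) (auto simp: exact_period_def)
  moreover have "gcd k k' > 0" using assms(2) by simp
  ultimately have "gcd k k' = k" using assms(1) gcd_dvd1 unfolding exact_period_def by blast
  then show ?thesis by (metis gcd_dvd2)
qed

lemma exact_period_unique:
  assumes "exact_period l k z" "exact_period l k' z" "k > 0" "k' > 0"
  shows "k = k'"
  using assms exact_period_dvd by (meson dvd_antisym exact_period_def)

lemma exact_period_exists:
  assumes "n > 0" "poly (p (l + n)) z = poly (p l) z"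
  obtains k where "k dvd n" "exact_period l k z"
proof -
  define Q where "Q k \<longleftrightarrow> k > 0 \<and> k dvd n \<and> poly (p (l + k)) z = poly (p l) z" for k
  define k where "k = (LEAST k. Q k)"
  have "Q n" using assms by (simp add: Q_def)
  then have k: "Q k" unfolding k_def by (rule LeastI)
  have "\<not> Q d" if "d dvd k" "d \<noteq> k" for d
  proof -
    have "d < k" using that k by (auto simp: Q_def dvd_imp_le le_neq_implies_less)
    then show ?thesis unfolding k_def by (rule not_less_Least)
  qed
  then have "exact_period l k z"
    using k by (auto simp: exact_period_def Q_def intro: dvd_trans)
  with k show ?thesis by (intro that) (auto simp: Q_def)
qed

lemma Hyp_orbit:
  assumes "z \<in> Hyp k" "k dvd n"
  shows "poly (p (i + n)) z = poly (p i) z"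
proof -
  have "poly (p (0 + n)) z = poly (p 0) z"
    using assms(1) by (intro p_orbit_dvd[OF _ assms(2)]) (simp add: Hyp_iff exact_period_def)
  then show ?thesis by (rule p_orbit_ge) simp
qed

lemma Hyp_zero_iff:
  assumes "z \<in> Hyp k" "k > 0"
  shows "poly (p a) z = 0 \<longleftrightarrow> k dvd a"
  using exact_period_dvd[of 0 k z a] Hyp_orbit[OF assms(1), of a 0] assms by (auto simp: Hyp_iff)

text \<open>This identifies \<open>j\<close> as the exact preperiod, whichever multiple
  \<open>n\<close> of \<open>k\<close> is used as period.\<close>

lemma Mis_orbit_iff:
  assumes "z \<in> Mis j k" "k dvd n" "n > 0" "j > 0"
  shows "poly (p (i + n)) z = poly (p i) z \<longleftrightarrow> j \<le> i"
proof
  have jk: "poly (p (j + k)) z = poly (p j) z"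
    using assms by (simp add: Mis_iff exact_period_def)
  {
    assume "j \<le> i"
    then show "poly (p (i + n)) z = poly (p i) z"
      using p_orbit_ge p_orbit_dvd[OF jk assms(2)] by blast
  }
  assume i: "poly (p (i + n)) z = poly (p i) z"
  show "j \<le> i"
  proof (rule ccontr)
    assume "\<not> j \<le> i"
    then have n: "poly (p (j - 1 + n)) z = poly (p (j - 1)) z"
      using p_orbit_ge[OF i, of "j - 1"] by simp
    \<comment> \<open>Since \<open>n > 0\<close>, shifting \<open>j - 1\<close> by \<open>n\<close>
      lands in the periodic tail, where \<open>k\<close> is a period; the period \<open>n\<close> at
      \<open>j - 1\<close> carries this back to \<open>j - 1\<close>.\<close>
    have "poly (p (j - 1 + n + k)) z = poly (p (j - 1 + n)) z"
      using assms by (intro p_orbit_ge[OF jk]) simp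
    with p_orbit_shift[OF n, of k] n have "poly (p (j - 1 + k)) z = poly (p (j - 1)) z" by simp
    with assms show False by (simp add: Mis_iff)
  qed
qed

lemma Mis_nonzero:
  assumes "z \<in> Mis j k" "k > 0" "j > 0" "a > 0"
  shows "poly (p a) z \<noteq> 0"
proof
  assume "poly (p a) z = 0"
  then have "poly (p (0 + a)) z = poly (p 0) z" by simp
  \<comment> \<open>A return to 0 makes the orbit periodic from index 0; \<open>a * k\<close> is a
    period that is also a multiple of \<open>k\<close>, contradicting the preperiod
    \<open>j > 0\<close>.\<close>
  then have "poly (p (0 + a * k)) z = poly (p 0) z" by (rule p_orbit_mult)
  then show False using Mis_orbit_iff[OF assms(1), of "a * k" 0] assms by simp
qed

text \<open>Each root is classified by its preperiod \<open>j\<close>, the least index from which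
  \<open>n\<close> is a period, and by the exact period \<open>k\<close> of the tail.\<close>

lemma roots_q:
  assumes "n \<ge> 1"
  shows "{z. poly (q l n) z = 0} =
      (\<Union>k \<in> {k. k dvd n}. Hyp k \<union> (\<Union>j \<in> {2..l}. Mis j k))" (is "?L = ?R")
proof (intro equalityI subsetI)
  fix z assume "z \<in> ?L"
  then have l: "poly (p (l + n)) z = poly (p l) z" by (simp add: q_def)
  define Q where "Q j \<longleftrightarrow> poly (p (j + n)) z = poly (p j) z" for j
  define j where "j = (LEAST j. Q j)"
  have "Q l" using l by (simp add: Q_def)
  then have Qj: "Q j" and jl: "j \<le> l"
    unfolding j_def by (rule LeastI, rule Least_le)
  obtain k where k: "k dvd n" "exact_period j k z"
    using exact_period_exists[of n j z] Qj assms by (auto simp: Q_def)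
  show "z \<in> ?R"
  proof (cases "j = 0")
    case True
    with k show ?thesis by (auto simp: Hyp_iff)
  next
    case False
    then have nQ: "\<not> Q (j - 1)"
      unfolding j_def by (intro not_less_Least) simp
    \<comment> \<open>Preperiod 1 cannot occur: \<open>p (1 + n)\<close> and \<open>p 1\<close>
      agree at \<open>z\<close> only if the square of \<open>p n\<close> vanishes there, and then
      \<open>n\<close> is a period from index 0.\<close>
    have "j \<noteq> 1" using Qj nQ by (auto simp: Q_def)
    moreover have "poly (p (j - 1 + k)) z \<noteq> poly (p (j - 1)) z"
      using nQ p_orbit_dvd[OF _ k(1), of "j - 1" z] by (auto simp: Q_def)
    ultimately have "z \<in> Mis j k" "j \<in> {2..l}" using k jl False by (auto simp: Mis_iff)
    with k show ?thesis by blast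
  qed
next
  fix z assume "z \<in> ?R"
  then obtain k where k: "k dvd n" "z \<in> Hyp k \<or> (\<exists>j\<in>{2..l}. z \<in> Mis j k)" by blast
  then have "poly (p (l + n)) z = poly (p l) z"
    using Hyp_orbit[of z k n l] Mis_orbit_iff[of z _ k n l] assms by auto
  then show "z \<in> ?L" by (simp add: q_def)
qed

section \<open>Multiplicities\<close>

lemma card_multiples_less_Suc:
  "k > 0 \<Longrightarrow> card {a. a < Suc l \<and> k dvd a} = l div k + 1"
proof (induction l)
  case 0
  have "{a. a < Suc 0 \<and> k dvd a} = {0}" by auto
  then show ?case by simp
next
  case (Suc l)
  have "{a. a < Suc (Suc l) \<and> k dvd a}
      = {a. a < Suc l \<and> k dvd a} \<union> (if k dvd Suc l then {Suc l} else {})"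
    by (auto simp: less_Suc_eq)
  also have "card \<dots> = card {a. a < Suc l \<and> k dvd a} + of_bool (k dvd Suc l)"
    by (subst card_Un_disjoint) auto
  finally show ?case using Suc by (simp add: div_Suc dvd_eq_mod_eq_0)
qed

text \<open>This puts the floor formula in the shape of \<open>order_q\<close>: 1 for the factor
  \<open>p n\<close>, and one for each multiple of \<open>k\<close> below \<open>l\<close>.\<close>

lemma \<eta>_eq_card:
  assumes "k > 0"
  shows "\<eta> l k = 1 + card {a. a < l \<and> k dvd a}"
proof (cases l)
  case 0
  have "\<lfloor>- 1 / real k\<rfloor> = - 1"
    using assms by (simp add: floor_eq_iff field_simps)
  with 0 show ?thesis by (simp add: \<eta>_def)
next
  case (Suc l')
  have "\<lfloor>real l' / real k\<rfloor> = int (l' div k)" by (rule floor_divide_of_nat_eq)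
  with Suc assms show ?thesis
    by (simp add: \<eta>_def card_multiples_less_Suc nat_add_distrib del: of_nat_div)
qed

lemma order_q_Hyp:
  assumes "n \<ge> 1" "k dvd n" "z \<in> Hyp k"
  shows "order z (q l n) = \<eta> l k"
proof -
  have k: "k > 0" using assms by (auto intro: Nat.gr0I)
  \<comment> \<open>By periodicity the sum is twice the value of \<open>p a\<close> at
    \<open>z\<close>.\<close>
  have "poly (p (a + n) + p a) z = 0 \<longleftrightarrow> k dvd a" for a
    using Hyp_orbit[OF assms(3,2), of a] Hyp_zero_iff[OF assms(3) k, of a] by simp
  moreover have "poly (p n) z = 0" using Hyp_zero_iff[OF assms(3) k] assms(2) by simp
  ultimately show ?thesis by (simp add: order_q[OF assms(1)] \<eta>_eq_card[OF k])
qed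

text \<open>The root enters in passing from \<open>q (j - 1) n\<close> to \<open>q j n\<close>, so
  only the factor with \<open>a = j - 1\<close> vanishes: earlier ones divide a nonzero
  \<open>q (Suc a) n\<close>, later ones are twice a nonzero orbit value.\<close>

lemma order_q_Mis:
  assumes "n \<ge> 1" "k dvd n" "j \<in> {2..l}" "z \<in> Mis j k"
  shows "order z (q l n) = 1"
proof -
  have k: "k > 0" using assms by (auto intro: Nat.gr0I)
  have j: "j > 0" using assms by simp
  note orb = Mis_orbit_iff[OF assms(4,2) _ j] and nz = Mis_nonzero[OF assms(4) k j]
  have "poly (p (a + n) + p a) z = 0 \<longleftrightarrow> a = j - 1" for a
  proof
    assume r: "poly (p (a + n) + p a) z = 0"
    then have "poly (q (Suc a) n) z = 0" by (simp add: q_Suc del: p.simps)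
    then have ja: "j \<le> Suc a" using orb[of "Suc a"] assms by (simp add: q_def del: p.simps)
    have "\<not> j \<le> a"
    proof
      assume ge: "j \<le> a"
      then have "poly (p (a + n)) z = poly (p a) z" using orb assms by simp
      with r have "poly (p a) z = 0" by simp
      with nz[of a] ge j show False by simp
    qed
    with ja show "a = j - 1" by simp
  next
    assume a: "a = j - 1"
    have "\<not> j \<le> a" using a j by simp
    then have "poly (q a n) z \<noteq> 0" using orb[of a] assms by (simp add: q_def)
    moreover have "poly (q (Suc a) n) z = 0"
      using orb[of "Suc a"] assms a j by (simp add: q_def del: p.simps)
    ultimately show "poly (p (a + n) + p a) z = 0" by (simp add: q_Suc)
  qed
  then have "{a. a < l \<and> poly (p (a + n) + p a) z = 0} = {j - 1}" using assms by auto
  then show ?thesis using nz[of n] assms by (simp add: order_q[OF assms(1)])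
qed

section \<open>Factorization\<close>

lemma q_factorization:
  assumes "n \<ge> 1"
  shows "q l n = (\<Prod>k | k dvd n. h k ^ \<eta> l k * (\<Prod>j = 2..l. m j k))"
proof -
  define A where "A k = Hyp k \<union> (\<Union>j \<in> {2..l}. Mis j k)" for k
  define F where "F z = [:- z, 1:] ^ order z (q l n)" for z
  have pos: "k > 0" if "k dvd n" for k using that assms by (auto intro: Nat.gr0I)
  have finA: "finite (A k)" if "k dvd n" for k
    using pos[OF that] by (auto simp: A_def intro!: finite_Hyp finite_Mis)
  \<comment> \<open>Index 0 separates the two: \<open>n\<close> is a period from there on
    \<open>Hyp k\<close> but not on \<open>Mis j k'\<close>.\<close>
  have HM: "Hyp k \<inter> Mis j k' = {}" if "k dvd n" "k' dvd n" "j \<in> {2..l}" for j k k'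
    using that assms Hyp_orbit[of _ k n 0] Mis_orbit_iff[of _ j k' n 0] by fastforce
  \<comment> \<open>Both indices are the least one from which the common multiple \<open>n\<close>
    is a period.\<close>
  have MM: "j = j'" if "k dvd n" "k' dvd n" "j \<in> {2..l}" "j' \<in> {2..l}"
    "z \<in> Mis j k" "z \<in> Mis j' k'" for j j' k k' z
  proof -
    have "j \<le> i \<longleftrightarrow> j' \<le> i" for i
      using that assms Mis_orbit_iff[of z j k n i] Mis_orbit_iff[of z j' k' n i] by auto
    then show ?thesis by (meson le_antisym order_refl)
  qed
  have disj: "A k \<inter> A k' = {}" if kk: "k dvd n" "k' dvd n" "k \<noteq> k'" for k k'
  proof -
    have pos': "k > 0" "k' > 0" using that pos by auto
    have "Hyp k \<inter> Hyp k' = {}"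
      using that pos' exact_period_unique[of 0 k _ k'] by (auto simp: Hyp_iff)
    moreover have "Mis j k \<inter> Mis j' k' = {}" if jj: "j \<in> {2..l}" "j' \<in> {2..l}" for j j'
    proof (rule equals0I)
      fix z assume z: "z \<in> Mis j k \<inter> Mis j' k'"
      then have "j = j'" using MM[OF kk(1,2) jj] by blast
      with z have "exact_period j k z" "exact_period j k' z" by (auto simp: Mis_iff)
      then have "k = k'" using pos' by (rule exact_period_unique)
      with kk show False by simp
    qed
    ultimately show ?thesis
      using that HM[of k k'] HM[of k' k] unfolding A_def by blast
  qed
  \<comment> \<open>Splitting over the complex numbers; \<open>q l n\<close> is monic, so no scalar
    remains. The roots are then regrouped by exact period and preperiod.\<close>
  have "q l n = (\<Prod>z | poly (q l n) z = 0. F z)"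
    using complex_poly_decompose[of "q l n"] by (simp add: lead_coeff_q[OF assms] F_def)
  also have "\<dots> = (\<Prod>k | k dvd n. \<Prod>z\<in>A k. F z)"
    unfolding roots_q[OF assms] A_def[symmetric]
    using assms finA disj by (intro prod.UNION_disjoint) auto
  also have "\<dots> = (\<Prod>k | k dvd n. h k ^ \<eta> l k * (\<Prod>j = 2..l. m j k))"
  proof (rule prod.cong[OF refl], clarify)
    fix k assume k: "k dvd n"
    have "Hyp k \<inter> (\<Union>j \<in> {2..l}. Mis j k) = {}" using HM[OF k k] by blast
    then have "(\<Prod>z\<in>A k. F z) = (\<Prod>z\<in>Hyp k. F z) * (\<Prod>z\<in>(\<Union>j \<in> {2..l}. Mis j k). F z)"
      unfolding A_def using pos[OF k]
      by (intro prod.union_disjoint) (auto intro!: finite_Hyp finite_Mis)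
    also have "(\<Prod>z\<in>Hyp k. F z) = h k ^ \<eta> l k"
      unfolding h_def prod_power_distrib
      by (intro prod.cong) (auto simp: F_def order_q_Hyp[OF assms k])
    also have "(\<Prod>z\<in>(\<Union>j \<in> {2..l}. Mis j k). F z) = (\<Prod>j = 2..l. \<Prod>z\<in>Mis j k. F z)"
      using pos[OF k] MM[OF k k]
      by (intro prod.UNION_disjoint) (auto intro!: finite_Mis)
    also have "\<dots> = (\<Prod>j = 2..l. m j k)"
      unfolding m_def
      by (intro prod.cong) (auto simp: F_def order_q_Mis[OF assms k])
    finally show "(\<Prod>z\<in>A k. F z) = h k ^ \<eta> l k * (\<Prod>j = 2..l. m j k)" .
  qed
  finally show ?thesis .
qed

theorem theorem2:
  fixes l n :: nat
  assumes "n \<ge> 1"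
  shows "q l n = (\<Prod>k | k dvd n. h k ^ \<eta> l k * (\<Prod>j = 2..l. m j k)) \<and>
    {z. poly (q l n) z = 0} =
      (\<Union>k \<in> {k. k dvd n}. Hyp k \<union> (\<Union>j \<in> {2..l}. Mis j k)) \<and>
    (\<forall>k z. k dvd n \<longrightarrow> z \<in> Hyp k \<longrightarrow> order z (q l n) = \<eta> l k) \<and>
    (\<forall>j k z. k dvd n \<longrightarrow> j \<in> {2..l} \<longrightarrow> z \<in> Mis j k \<longrightarrow> order z (q l n) = 1)"
  using assms by (intro conjI allI impI q_factorization roots_q order_q_Hyp order_q_Mis)

end
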